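(* Let $A\in\mathbb{C}^{m\times n}$, $\mathbf{x}_*\in\mathbb{C}^n$ and $\mathbf{b}=A\mathbf{x}_*$. Let $r$ be any integer with $\sigma_r(A)>\sigma_{r+1}(A)$. For any $(\tilde A,\tilde{\mathbf{b}})=(A+\Delta A,\ \mathbf{b}+\Delta\mathbf{b})\in\mathbb{C}^{m\times n}\times\mathbb{C}^m$ serving as empirical data of $(A,\mathbf{b})$ with $$\|\Delta A\|_2<\min\{\sigma_r(A)-\sigma_{r+1}(A),\ (2\sqrt3-3)\,\sigma_r(A)\},$$ there is an $\tilde{\mathbf{x}}\in\mathrm{sol}_\theta(\tilde A,\tilde{\mathbf{b}})$ with $\sigma_{r+1}(\tilde A)<\theta<\sigma_r(\tilde A)$ such that $$\frac{\|\tilde{\mathbf{x}}-\mathbf{x}_*\|_2}{\|\mathbf{x}_*\|_2}\le\frac{\sigma_1(A)}{\sigma_r(A)}\,\frac{1}{1-\frac{\sigma_{r+1}(A)+\|\Delta A\|_2}{\sigma_r(A)}}\left((2+\sqrt2)\,\frac{\|\Delta A\|_2}{\|A\|_2}+\frac{\|\Delta\mathbf{b}\|_2}{\|\mathbf{b}\|_2}\right).$$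
   Context: $\sigma_j(G)$ denotes the $j$-th largest singular value of $G\in\mathbb{C}^{m\times n}$ (zero for $j>\min\{m,n\}$); $\|\cdot\|_2$ is the Euclidean vector norm or the spectral matrix norm; $G^\dagger$ is the Moore-Penrose inverse of $G$. On $\mathbb{C}^{m\times n}\times\mathbb{C}^m$ the norm is $\|(G,\mathbf{d})\|=\sqrt{\|G\|_2^2+\|\mathbf{d}\|_2^2}$. With a singular value decomposition $G=\sum_j\sigma_j(G)\,\mathbf{u}_j\mathbf{v}_j^{H}$ and an error tolerance $\theta>0$ that is not a singular value of $G$, the $\theta$-projection of $G$ is $G_\theta=\sum_{\sigma_j(G)>\theta}\sigma_j(G)\,\mathbf{u}_j\mathbf{v}_j^{H}$. For $\mathbf{d}\in\mathbb{C}^m$, $\mathbf{d}_\theta:=G_\theta G_\theta^\dagger\mathbf{d}$ is the orthogonal projection of $\mathbf{d}$ onto the range of $G_\theta$. Write $\mathrm{sol}(G,\mathbf{d}):=\{\mathbf{u}\in\mathbb{C}^n : G\mathbf{u}=\mathbf{d}\}$. The general numerical solution of $G\mathbf{x}=\mathbf{d}$ within $\theta$ is $\mathrm{sol}_\theta(G,\mathbf{d}):=\mathrm{sol}(G_\theta,\mathbf{d}_\theta)$ if $\|(G,\mathbf{d})-(G_\theta,\mathbf{d}_\theta)\|<\theta$, and $\mathrm{sol}_\theta(G,\mathbf{d}):=\emptyset$ if $\|(G,\mathbf{d})-(G_\theta,\mathbf{d}_\theta)\|>\theta$; it is undefined if $\theta$ is a singular value of $G$ or equals $\|(G,\mathb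f{d})-(G_\theta,\mathbf{d}_\theta)\|$.
   Formalization: "Serving as empirical data" is read as: some θ with σ_{r+1}(Ã)<θ<σ_r(Ã) exceeds ‖(Ã,b̃)−(Ã_θ,b̃_θ)‖; otherwise sol_θ may be empty (A=diag(2,1), r=1, x_*=(0,100), no perturbation). Also b≠0 is assumed so that ‖Δb‖/‖b‖ is defined. *)

theory Defs
  imports "HOL-Analysis.Analysis"
begin

text \<open>
  The library norm on \<open>complex^'n\<close> is the Euclidean norm. The library norm on
  \<open>complex^'n^'m\<close> is the Frobenius norm, so the spectral norm is introduced as an
  operator norm.
\<close>

definition spectral_norm :: "complex^'n^'m \<Rightarrow> real" where
  "spectral_norm G = onorm (\<lambda>x. G *v x)"

definition pair_norm :: "complex^'n^'m \<Rightarrow> complex^'m \<Rightarrow> real" where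
  "pair_norm G d = sqrt ((spectral_norm G)\<^sup>2 + (norm d)\<^sup>2)"

definition conj_transpose :: "complex^'n^'m \<Rightarrow> complex^'m^'n" where
  "conj_transpose G = (\<chi> i j. cnj (G $ j $ i))"

definition outer_prod :: "complex^'m \<Rightarrow> complex^'n \<Rightarrow> complex^'n^'m" where
  "outer_prod u v = (\<chi> i j. u $ i * cnj (v $ j))"

text \<open>The library inner product on \<open>complex^'n\<close> is the real one, hence the explicit sum.\<close>

definition orthonormal_upto :: "nat \<Rightarrow> (nat \<Rightarrow> complex^'n) \<Rightarrow> bool" where
  "orthonormal_upto p w \<longleftrightarrow>
     (\<forall>i\<in>{1..p}. \<forall>j\<in>{1..p}.
        (\<Sum>k\<in>UNIV. cnj (w i $ k) * w j $ k) = (if i = j then 1 else 0))"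

text \<open>
  Singular value decomposition with \<open>p = min m n\<close> terms, indexed from 1: the
  coefficients are nonnegative and nonincreasing, and extended by zero beyond \<open>p\<close>.
  The values at index 0 carry no meaning.
\<close>

definition is_svd ::
  "complex^'n^'m \<Rightarrow> (nat \<Rightarrow> real) \<Rightarrow> (nat \<Rightarrow> complex^'m) \<Rightarrow> (nat \<Rightarrow> complex^'n) \<Rightarrow> bool" where
  "is_svd G s u v \<longleftrightarrow>
     (let p = min CARD('m) CARD('n) in
        (\<forall>j. 0 \<le> s j) \<and>
        (\<forall>i j. 1 \<le> i \<longrightarrow> i \<le> j \<longrightarrow> s j \<le> s i) \<and>
        (\<forall>j>p. s j = 0) \<and>
        orthonormal_upto p u \<and> orthonormal_upto p v \<and>
        G = (\<Sum>j=1..p. s j *\<^sub>R outer_prod (u j) (v j)))"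

text \<open>
  A chosen decomposition. The singular values at indices \<open>j \<ge> 1\<close> and the projection
  \<open>theta_proj\<close> for \<open>\<theta> > 0\<close> do not depend on the choice.
\<close>

definition svd ::
  "complex^'n^'m \<Rightarrow> (nat \<Rightarrow> real) \<times> (nat \<Rightarrow> complex^'m) \<times> (nat \<Rightarrow> complex^'n)" where
  "svd G = (SOME (s, u, v). is_svd G s u v)"

definition singular_value :: "complex^'n^'m \<Rightarrow> nat \<Rightarrow> real" where
  "singular_value G j = fst (svd G) j"

definition theta_proj :: "real \<Rightarrow> complex^'n^'m \<Rightarrow> complex^'n^'m" where
  "theta_proj \<theta> G =
     (case svd G of (s, u, v) \<Rightarrow>
        (\<Sum>j | j \<in> {1..min CARD('m) CARD('n)} \<and> s j > \<theta>. s j *\<^sub>R outer_prod (u j) (v j)))"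

text \<open>The Moore-Penrose inverse is the unique solution of the four Penrose equations.\<close>

definition moore_penrose :: "complex^'n^'m \<Rightarrow> complex^'m^'n" where
  "moore_penrose G =
     (THE X. G ** X ** G = G \<and> X ** G ** X = X \<and>
             conj_transpose (G ** X) = G ** X \<and> conj_transpose (X ** G) = X ** G)"

definition theta_proj_vec :: "real \<Rightarrow> complex^'n^'m \<Rightarrow> complex^'m \<Rightarrow> complex^'m" where
  "theta_proj_vec \<theta> G d = (theta_proj \<theta> G ** moore_penrose (theta_proj \<theta> G)) *v d"

definition sol :: "complex^'n^'m \<Rightarrow> complex^'m \<Rightarrow> (complex^'n) set" where
  "sol G d = {u. G *v u = d}"

definition theta_dist :: "real \<Rightarrow> complex^'n^'m \<Rightarrow> complex^'m \<Rightarrow> real" where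
  "theta_dist \<theta> G d = pair_norm (G - theta_proj \<theta> G) (d - theta_proj_vec \<theta> G d)"

text \<open>
  The general numerical solution within \<open>\<theta>\<close>. Where it is undefined (\<open>\<theta>\<close> not positive, a
  singular value, or equal to \<open>theta_dist \<theta> G d\<close>) the value is set to the empty set, so
  that membership entails that the numerical solution is defined.
\<close>

definition sol_theta :: "real \<Rightarrow> complex^'n^'m \<Rightarrow> complex^'m \<Rightarrow> (complex^'n) set" where
  "sol_theta \<theta> G d =
     (if 0 < \<theta> \<and> (\<forall>j\<ge>1. \<theta> \<noteq> singular_value G j) \<and> theta_dist \<theta> G d < \<theta>
      then sol (theta_proj \<theta> G) (theta_proj_vec \<theta> G d) else {})"

text \<open>
  \<open>(G, d)\<close> serves as data for a rank-\<open>r\<close> problem if some error tolerance separates the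
  \<open>r\<close>-th from the next singular value of \<open>G\<close> and exceeds the distance from \<open>(G, d)\<close> to its
  projection. For tolerances between these two singular values the projection and hence
  the distance do not depend on \<open>\<theta>\<close>. Nothing is required of the system underlying the data.
\<close>

definition serves_as_data :: "nat \<Rightarrow> complex^'n^'m \<Rightarrow> complex^'m \<Rightarrow> bool" where
  "serves_as_data r G d \<longleftrightarrow>
     (\<exists>\<theta>. singular_value G (r + 1) < \<theta> \<and> \<theta> < singular_value G r \<and> theta_dist \<theta> G d < \<theta>)"

end

theory Submission
  imports Defs
begin

text \<open>
  Among all solutions of the projected system, the one closest to \<open>x\<close> is close enough. Let
  \<open>P\<close> be the \<open>\<theta>\<close>-projection of \<open>A'\<close> and \<open>X\<close> its Moore-Penrose inverse. The vector
  \<open>x' = x + X (b' - P x)\<close> satisfies \<open>P x' = P X b'\<close>, hence is a numerical solution, and it is the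
  orthogonal projection of \<open>x\<close> onto the solution set. Truncation does not disturb the correction
  term: \<open>X\<close> annihilates the left singular vectors that \<open>P\<close> drops, so \<open>X P = X A'\<close> and
  \[ x' - x = X (b' - A' x) = X (\<Delta>b - \<Delta>A x). \]
  The singular values of \<open>X\<close> are reciprocals of singular values of \<open>A'\<close> up to index \<open>r\<close>, so the
  spectral norm of \<open>X\<close> is at most \<open>1 / \<sigma>\<^sub>r(A')\<close>; the lemma \<open>sol_theta_near\<close> records the resulting
  distance estimate. Weyl's inequality (\<open>singular_value_perturbation\<close>) bounds \<open>\<sigma>\<^sub>r(A')\<close> below by
  \<open>\<sigma>\<^sub>r(A) - \<parallel>\<Delta>A\<parallel>\<close>, which is at least \<open>\<sigma>\<^sub>r(A) - \<sigma>\<^sub>r\<^sub>+\<^sub>1(A) - \<parallel>\<Delta>A\<parallel> > 0\<close>. Finally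
  \<open>\<parallel>b\<parallel> \<le> \<parallel>A\<parallel> \<parallel>x\<parallel>\<close> and \<open>\<parallel>A\<parallel> \<le> \<sigma>\<^sub>1(A)\<close> turn absolute errors into relative ones at the cost of the
  factor \<open>\<sigma>\<^sub>1(A)\<close>.

  Since \<open>svd\<close> picks a decomposition by choice, its properties rest on the existence of one
  (\<open>exists_svd\<close>). It is built greedily: the next right singular vector maximises \<open>\<parallel>G v\<parallel>\<close> over
  the unit vectors orthogonal to the previous ones.
\<close>

section \<open>The Hermitian inner product\<close>

definition hinner :: "complex^'n \<Rightarrow> complex^'n \<Rightarrow> complex" where
  "hinner x y = (\<Sum>k\<in>UNIV. cnj (x $ k) * y $ k)"

lemma hinner_add_right: "hinner x (y + z) = hinner x y + hinner x z"
  by (simp add: hinner_def algebra_simps sum.distrib)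

lemma hinner_diff_right: "hinner x (y - z) = hinner x y - hinner x z"
  by (simp add: hinner_def algebra_simps sum_subtractf)

lemma hinner_smult_right: "hinner x (c *s y) = c * hinner x y"
  by (simp add: hinner_def algebra_simps sum_distrib_left)

lemma hinner_scaleR_right: "hinner x (c *\<^sub>R y) = c *\<^sub>R hinner x y"
  by (simp add: hinner_def scaleR_sum_right)

lemma hinner_zero_right [simp]: "hinner x 0 = 0"
  by (simp add: hinner_def)

lemma hinner_sum_right: "hinner x (\<Sum>i\<in>I. f i) = (\<Sum>i\<in>I. hinner x (f i))"
  by (induction I rule: infinite_finite_induct) (simp_all add: hinner_add_right)

lemma cnj_hinner: "cnj (hinner x y) = hinner y x"
  by (simp add: hinner_def algebra_simps)

lemma hinner_smult_left: "hinner (c *s x) y = cnj c * hinner x y"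
  by (simp add: hinner_def algebra_simps sum_distrib_left)

lemma hinner_scaleR_left: "hinner (c *\<^sub>R x) y = c *\<^sub>R hinner x y"
  by (simp add: hinner_def scaleR_sum_right)

lemma hinner_sum_left: "hinner (\<Sum>i\<in>I. f i) x = (\<Sum>i\<in>I. hinner (f i) x)"
  by (metis (no_types, lifting) cnj_hinner hinner_sum_right cnj_sum sum.cong)

lemma hinner_eq_0_commute: "hinner x y = 0 \<longleftrightarrow> hinner y x = 0"
  by (metis cnj_hinner complex_cnj_zero)

lemma Re_hinner: "Re (hinner x y) = x \<bullet> y"
  by (simp add: hinner_def inner_vec_def inner_complex_def)

lemma hinner_self: "hinner x x = of_real ((norm x)\<^sup>2)"
proof -
  have "hinner x x \<in> \<real>"
    using cnj_hinner[of x x] by (simp add: Reals_cnj_iff)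
  then show ?thesis
    using Re_hinner[of x x] by (metis of_real_Re power2_norm_eq_inner)
qed

lemma hinner_self_eq_0 [simp]: "hinner x x = 0 \<longleftrightarrow> x = 0"
  by (simp add: hinner_self)

lemma hinner_adjoint: "hinner (conj_transpose G *v y) x = hinner y (G *v x)"
  by (simp add: hinner_def conj_transpose_def matrix_vector_mult_def sum_distrib_left
      sum_distrib_right mult_ac) (rule sum.swap)

lemma continuous_on_hinner [continuous_intros]: "continuous_on S (hinner x)"
  unfolding hinner_def by (intro continuous_intros)

lemma outer_prod_mult_vec: "outer_prod a b *v x = hinner b x *s a"
  by (simp add: vec_eq_iff outer_prod_def hinner_def matrix_vector_mult_def sum_distrib_right
      sum_distrib_left mult_ac)

lemma matrix_scaleR_mult_vec: "(c *\<^sub>R G) *v (x :: complex^'n) = c *\<^sub>R (G *v x)"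
  by (simp add: vec_eq_iff matrix_vector_mult_def scaleR_sum_right)

lemma matrix_sum_mult_vec:
  "(\<Sum>i\<in>I. F i) *v (x :: complex^'n) = (\<Sum>i\<in>I. F i *v x)"
  by (induction I rule: infinite_finite_induct) (simp_all add: matrix_vector_mult_add_rdistrib)

lemma bounded_linear_matrix_vector_mult:
  "bounded_linear (\<lambda>x. (G :: complex^'n^'m) *v x)"
proof (rule linear_conv_bounded_linear[THEN iffD1], rule linearI)
  show "G *v (c *\<^sub>R x) = c *\<^sub>R (G *v x)" for c x
    by (simp add: vec_eq_iff matrix_vector_mult_def scaleR_sum_right)
qed (rule matrix_vector_right_distrib)

lemma norm_matrix_vector_mult_le: "norm (G *v x) \<le> spectral_norm G * norm x"
  unfolding spectral_norm_def by (rule onorm[OF bounded_linear_matrix_vector_mult])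

lemma spectral_norm_nonneg: "0 \<le> spectral_norm G"
  unfolding spectral_norm_def by (rule onorm_pos_le[OF bounded_linear_matrix_vector_mult])

lemma conj_transpose_mult: "conj_transpose (F ** G) = conj_transpose G ** conj_transpose F"
  by (simp add: vec_eq_iff conj_transpose_def matrix_matrix_mult_def mult.commute)

section \<open>Orthonormal families\<close>

definition orthonormal_on :: "'i set \<Rightarrow> ('i \<Rightarrow> complex^'n) \<Rightarrow> bool" where
  "orthonormal_on I w \<longleftrightarrow> (\<forall>i\<in>I. \<forall>j\<in>I. hinner (w i) (w j) = (if i = j then 1 else 0))"

lemma orthonormal_upto_iff: "orthonormal_upto p w \<longleftrightarrow> orthonormal_on {1..p} w"
  by (simp add: orthonormal_upto_def orthonormal_on_def hinner_def)

lemma orthonormal_on_subset: "orthonormal_on I w \<Longrightarrow> J \<subseteq> I \<Longrightarrow> orthonormal_on J w"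
  unfolding orthonormal_on_def by blast

lemma orthonormal_on_hinner:
  "orthonormal_on I w \<Longrightarrow> i \<in> I \<Longrightarrow> j \<in> I \<Longrightarrow> hinner (w i) (w j) = (if i = j then 1 else 0)"
  by (simp add: orthonormal_on_def)

lemma hinner_orthonormal_sum:
  assumes "finite I" "orthonormal_on I w" "i \<in> I"
  shows "hinner (w i) (\<Sum>j\<in>I. c j *s w j) = c i"
proof -
  have "hinner (w i) (\<Sum>j\<in>I. c j *s w j) = (\<Sum>j\<in>I. if i = j then c j else 0)"
    unfolding hinner_sum_right hinner_smult_right
    by (rule sum.cong) (use assms in \<open>auto simp: orthonormal_on_hinner\<close>)
  then show ?thesis using assms by simp
qed

lemma norm_orthonormal_sum:
  assumes "finite I" "orthonormal_on I w"
  shows "(norm (\<Sum>i\<in>I. c i *s w i))\<^sup>2 = (\<Sum>i\<in>I. (cmod (c i))\<^sup>2)"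
proof -
  let ?y = "\<Sum>i\<in>I. c i *s w i"
  have "of_real ((norm ?y)\<^sup>2) = hinner ?y ?y"
    by (simp add: hinner_self)
  also have "\<dots> = (\<Sum>i\<in>I. cnj (c i) * c i)"
    by (subst hinner_sum_left) (simp add: hinner_smult_left hinner_orthonormal_sum[OF assms])
  also have "\<dots> = of_real (\<Sum>i\<in>I. (cmod (c i))\<^sup>2)"
    by (simp add: complex_norm_square mult.commute del: of_real_power)
  finally show ?thesis
    using of_real_eq_iff by blast
qed

lemma bessel_inequality:
  assumes "finite I" "orthonormal_on I w"
  shows "(\<Sum>i\<in>I. (cmod (hinner (w i) x))\<^sup>2) \<le> (norm x)\<^sup>2"
proof -
  define y where "y = (\<Sum>i\<in>I. hinner (w i) x *s w i)"
  have orth: "hinner y (x - y) = 0"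
    by (subst y_def, subst hinner_sum_left)
      (simp add: hinner_smult_left hinner_diff_right y_def hinner_orthonormal_sum[OF assms])
  have "(norm x)\<^sup>2 = (norm (y + (x - y)))\<^sup>2"
    by simp
  also have "\<dots> = (norm y)\<^sup>2 + (norm (x - y))\<^sup>2"
    using orth Re_hinner[of y "x - y"] by (intro norm_add_Pythagorean) (simp add: orthogonal_def)
  finally show ?thesis
    using norm_orthonormal_sum[OF assms, of "\<lambda>i. hinner (w i) x"] by (simp add: y_def)
qed

lemma orthonormal_on_independent:
  assumes "finite I" "orthonormal_on I w"
  shows "vec.independent (w ` I)" "card (w ` I) = card I"
proof -
  have inj: "inj_on w I"
    using assms(2) by (intro inj_onI) (metis orthonormal_on_hinner zero_neq_one)
  then show "card (w ` I) = card I"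
    by (rule card_image)
  show "vec.independent (w ` I)"
  proof (rule vec.independent_if_scalars_zero)
    fix f y assume sum0: "(\<Sum>z\<in>w ` I. f z *s z) = 0" and "y \<in> w ` I"
    then obtain i where i: "i \<in> I" "y = w i" by blast
    have "(\<Sum>j\<in>I. f (w j) *s w j) = 0"
      using sum0 by (simp add: sum.reindex[OF inj])
    then show "f y = 0"
      using hinner_orthonormal_sum[OF assms i(1), of "\<lambda>j. f (w j)"] i(2) by simp
  qed (simp add: assms(1))
qed

text \<open>
  A homogeneous system with fewer equations than unknowns. The map
  \<open>x \<mapsto> \<Sum>\<^sub>j \<langle>z\<^sub>j, x\<rangle> z\<^sub>j\<close> has rank at most \<open>card J\<close>, so it is not injective on \<open>V\<close>; and because
  it is positive semidefinite with quadratic form \<open>\<Sum>\<^sub>j \<bar>\<langle>z\<^sub>j, x\<rangle>\<bar>\<^sup>2\<close>, its kernel is exactly the set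
  of vectors orthogonal to all \<open>z\<^sub>j\<close>.
\<close>

lemma exists_orthogonal_in_subspace:
  assumes V: "vec.subspace V" and J: "finite J" "card J < vec.dim V"
  shows "\<exists>x\<in>V. x \<noteq> 0 \<and> (\<forall>j\<in>J. hinner (z j) x = 0)"
proof (rule ccontr)
  assume contra: "\<not> ?thesis"
  define f where "f x = (\<Sum>j\<in>J. hinner (z j) x *s z j)" for x
  have lin: "Vector_Spaces.linear (*s) (*s) f"
    unfolding f_def
    by unfold_locales
      (simp_all add: hinner_add_right hinner_smult_right sum.distrib vec.scale_sum_right
        vec.scale_left_distrib vec.scale_right_distrib)
  have ker: "x = 0" if "x \<in> V" "f x = 0" for x
  proof -
    have "0 = hinner x (f x)" using that by simp
    also have "\<dots> = (\<Sum>j\<in>J. hinner (z j) x * cnj (hinner (z j) x))"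
      by (simp add: f_def hinner_sum_right hinner_smult_right cnj_hinner)
    also have "\<dots> = of_real (\<Sum>j\<in>J. (cmod (hinner (z j) x))\<^sup>2)"
      by (simp add: complex_norm_square del: of_real_power)
    finally have "(\<Sum>j\<in>J. (cmod (hinner (z j) x))\<^sup>2) = 0"
      by (metis of_real_eq_0_iff)
    then have "\<forall>j\<in>J. hinner (z j) x = 0"
      using J(1) by (simp add: sum_nonneg_eq_0_iff)
    then show ?thesis using contra that(1) by blast
  qed
  have "inj_on f (vec.span V)"
    using ker by (subst vec.linear_inj_on_iff_eq_0[OF lin]) (auto simp: V vec.span_eq_iff[THEN iffD2])
  then have "vec.dim (f ` V) = vec.dim V"
    by (rule vec.dim_image_eq[OF lin])
  moreover have "vec.dim (f ` V) \<le> card (z ` J)"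
  proof (rule vec.dim_le_card)
    show "f ` V \<subseteq> vec.span (z ` J)"
    proof (rule image_subsetI)
      show "f x \<in> vec.span (z ` J)" for x
        unfolding f_def by (intro vec.span_sum vec.span_scale vec.span_base imageI)
    qed
  qed (simp add: J(1))
  moreover have "card (z ` J) \<le> card J"
    by (rule card_image_le[OF J(1)])
  ultimately show False using J(2) by simp
qed

lemma exists_unit_orthogonal:
  fixes z :: "'i \<Rightarrow> complex^'n"
  assumes "finite J" "card J < CARD('n)"
  shows "\<exists>x. norm x = 1 \<and> (\<forall>j\<in>J. hinner (z j) x = 0)"
proof -
  obtain x where "x \<noteq> 0" "\<forall>j\<in>J. hinner (z j) x = 0"
    using exists_orthogonal_in_subspace[of UNIV J z] assms vec.subspace_UNIV by (auto simp: card_cart_basis)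
  then show ?thesis
    by (intro exI[of _ "(1 / norm x) *\<^sub>R x"]) (simp add: hinner_scaleR_right)
qed

text \<open>
  The difference of the two sides lies in the span and is orthogonal to it.
\<close>

lemma orthonormal_expansion_span:
  assumes "finite I" "orthonormal_on I w" "x \<in> vec.span (w ` I)"
  shows "x = (\<Sum>i\<in>I. hinner (w i) x *s w i)"
proof -
  define y where "y = x - (\<Sum>i\<in>I. hinner (w i) x *s w i)"
  have orth: "hinner (w i) y = 0" if "i \<in> I" for i
    using that by (simp add: y_def hinner_diff_right hinner_orthonormal_sum[OF assms(1,2)])
  have "y \<in> vec.span (w ` I)"
    unfolding y_def by (intro vec.span_diff assms(3) vec.span_sum vec.span_scale vec.span_base) auto
  moreover have "hinner y z = 0" if "z \<in> vec.span (w ` I)" for z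
    using that
  proof (induction rule: vec.span_induct)
    case base
    show ?case
      by (auto simp: vec.subspace_def hinner_add_right hinner_smult_right)
  next
    case (step z)
    then show ?case by (auto simp: orth hinner_eq_0_commute[of y])
  qed
  ultimately have "hinner y y = 0" by blast
  then show ?thesis by (simp add: y_def)
qed

lemma orthonormal_expansion:
  fixes w :: "'i \<Rightarrow> complex^'n"
  assumes "finite I" "orthonormal_on I w" "card I = CARD('n)"
  shows "x = (\<Sum>i\<in>I. hinner (w i) x *s w i)"
proof -
  note ind = orthonormal_on_independent[OF assms(1,2)]
  have "UNIV \<subseteq> vec.span (w ` I)"
    by (rule vec.card_ge_dim_independent)
      (use ind assms in \<open>auto simp: card_cart_basis\<close>)
  then show ?thesis
    using orthonormal_expansion_span[OF assms(1,2)] by blast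
qed

section \<open>Rank-one expansions\<close>

text \<open>
  Coefficients may vanish. A matrix, its truncations and their Moore-Penrose inverses are then
  all sums over the same index set, and products are computed by multiplying coefficients.
\<close>

definition rank_one_sum ::
  "'i set \<Rightarrow> ('i \<Rightarrow> real) \<Rightarrow> ('i \<Rightarrow> complex^'m) \<Rightarrow> ('i \<Rightarrow> complex^'n) \<Rightarrow> complex^'n^'m" where
  "rank_one_sum I c u v = (\<Sum>j\<in>I. c j *\<^sub>R outer_prod (u j) (v j))"

lemma rank_one_sum_mult_vec:
  "rank_one_sum I c u v *v x = (\<Sum>j\<in>I. (of_real (c j) * hinner (v j) x) *s u j)"
  unfolding rank_one_sum_def matrix_sum_mult_vec matrix_scaleR_mult_vec outer_prod_mult_vec
  by (rule sum.cong) (simp_all add: vec_eq_iff scaleR_conv_of_real[of _ "_ :: complex"] mult_ac)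

lemma rank_one_sum_mult:
  assumes "finite I" "orthonormal_on I v"
  shows "rank_one_sum I c u v ** rank_one_sum I d v w = rank_one_sum I (\<lambda>j. c j * d j) u w"
proof -
  have "(rank_one_sum I c u v ** rank_one_sum I d v w) *v x
      = rank_one_sum I (\<lambda>j. c j * d j) u w *v x" for x
    unfolding matrix_vector_mul_assoc[symmetric] rank_one_sum_mult_vec
    by (rule sum.cong) (simp_all add: hinner_orthonormal_sum[OF assms] mult_ac)
  then show ?thesis by (simp add: matrix_eq)
qed

lemma conj_transpose_rank_one_sum: "conj_transpose (rank_one_sum I c u v) = rank_one_sum I c v u"
  by (simp add: vec_eq_iff rank_one_sum_def conj_transpose_def outer_prod_def mult_ac)

lemma norm_rank_one_sum_mult_vec:
  assumes "finite I" "orthonormal_on I u"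
  shows "(norm (rank_one_sum I c u v *v x))\<^sup>2 = (\<Sum>j\<in>I. (c j)\<^sup>2 * (cmod (hinner (v j) x))\<^sup>2)"
  unfolding rank_one_sum_mult_vec norm_orthonormal_sum[OF assms]
  by (simp add: norm_mult power_mult_distrib)

text \<open>
  The coefficients are bounded only where \<open>x\<close> has a component. This gives the spectral norm when
  \<open>x\<close> is arbitrary, and the sharper bound on a complement of leading singular vectors that Weyl's
  inequality uses.
\<close>

lemma norm_rank_one_sum_mult_vec_le:
  assumes "finite I" "orthonormal_on I u" "orthonormal_on I v" "0 \<le> M"
    and "\<And>j. j \<in> I \<Longrightarrow> hinner (v j) x \<noteq> 0 \<Longrightarrow> \<bar>c j\<bar> \<le> M"
  shows "norm (rank_one_sum I c u v *v x) \<le> M * norm x"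
proof (rule power2_le_imp_le)
  have "(norm (rank_one_sum I c u v *v x))\<^sup>2 \<le> (\<Sum>j\<in>I. M\<^sup>2 * (cmod (hinner (v j) x))\<^sup>2)"
    unfolding norm_rank_one_sum_mult_vec[OF assms(1,2)]
  proof (rule sum_mono)
    fix j assume "j \<in> I"
    show "(c j)\<^sup>2 * (cmod (hinner (v j) x))\<^sup>2 \<le> M\<^sup>2 * (cmod (hinner (v j) x))\<^sup>2"
    proof (cases "hinner (v j) x = 0")
      case False
      with \<open>j \<in> I\<close> have "\<bar>c j\<bar> \<le> M" by (rule assms(5))
      then have "(c j)\<^sup>2 \<le> M\<^sup>2" by (simp add: abs_le_square_iff[symmetric] \<open>0 \<le> M\<close>)
      then show ?thesis by (rule mult_right_mono) simp
    qed simp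
  qed
  also have "\<dots> \<le> M\<^sup>2 * (norm x)\<^sup>2"
    unfolding sum_distrib_left[symmetric]
    by (intro mult_left_mono bessel_inequality assms) simp
  finally show "(norm (rank_one_sum I c u v *v x))\<^sup>2 \<le> (M * norm x)\<^sup>2"
    by (simp add: power_mult_distrib)
qed (simp add: \<open>0 \<le> M\<close>)

text \<open>
  Penrose's uniqueness argument: for two solutions \<open>X\<close> and \<open>Y\<close>, the products \<open>G X\<close> and \<open>G Y\<close> are
  orthogonal projections onto the range of \<open>G\<close>, hence equal, and dually \<open>X G = Y G\<close>.
\<close>

lemma moore_penrose_eqI:
  assumes X: "G ** X ** G = G" "X ** G ** X = X"
    "conj_transpose (G ** X) = G ** X" "conj_transpose (X ** G) = X ** G"
  shows "moore_penrose G = X"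
  unfolding moore_penrose_def
proof (rule the_equality)
  fix Y assume Y: "G ** Y ** G = G \<and> Y ** G ** Y = Y \<and>
    conj_transpose (G ** Y) = G ** Y \<and> conj_transpose (Y ** G) = Y ** G"
  have left: "G ** Y = G ** X"
  proof -
    have "G ** Y = (G ** X) ** (G ** Y)"
      by (simp add: matrix_mul_assoc X(1))
    also have "\<dots> = conj_transpose ((G ** Y) ** (G ** X))"
      using X Y by (simp add: conj_transpose_mult[of "G ** Y"])
    also have "(G ** Y) ** (G ** X) = G ** X"
      using Y by (simp add: matrix_mul_assoc)
    finally show ?thesis using X by simp
  qed
  have right: "Y ** G = X ** G"
  proof -
    have "Y ** G = (Y ** G) ** (X ** G)"
      by (simp add: matrix_mul_assoc[symmetric]) (simp add: matrix_mul_assoc X(1))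
    also have "\<dots> = conj_transpose ((X ** G) ** (Y ** G))"
      using X Y by (simp add: conj_transpose_mult[of "X ** G"])
    also have "(X ** G) ** (Y ** G) = X ** G"
      using Y by (simp add: matrix_mul_assoc[symmetric])
    finally show ?thesis using X by simp
  qed
  have "Y = (Y ** G) ** Y" using Y by simp
  also have "\<dots> = X ** (G ** Y)" by (simp add: right matrix_mul_assoc)
  also have "\<dots> = X" by (simp add: left X matrix_mul_assoc)
  finally show "Y = X" .
qed (use X in blast)

text \<open>
  As \<open>inverse 0 = 0\<close>, inverting every coefficient inverts the nonzero ones and keeps the others
  zero, which is what the Penrose equations ask for.
\<close>

lemma moore_penrose_rank_one_sum:
  assumes "finite I" "orthonormal_on I u" "orthonormal_on I v"
  shows "moore_penrose (rank_one_sum I c u v) = rank_one_sum I (\<lambda>j. inverse (c j)) v u"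
proof (rule moore_penrose_eqI)
  have c: "c j * inverse (c j) * c j = c j" "inverse (c j) * c j * inverse (c j) = inverse (c j)" for j
    by (cases "c j = 0"; simp)+
  let ?G = "rank_one_sum I c u v" and ?X = "rank_one_sum I (\<lambda>j. inverse (c j)) v u"
  note mult = rank_one_sum_mult[OF assms(1,2)] rank_one_sum_mult[OF assms(1,3)]
  show "?G ** ?X ** ?G = ?G" "?X ** ?G ** ?X = ?X"
    by (simp_all only: mult c)
  show "conj_transpose (?G ** ?X) = ?G ** ?X" "conj_transpose (?X ** ?G) = ?X ** ?G"
    by (simp_all only: mult conj_transpose_rank_one_sum)
qed

section \<open>Existence of the singular value decomposition\<close>

lemma exists_norm_maximizer_orthogonal:
  fixes G :: "complex^'n^'m" and z :: "'i \<Rightarrow> complex^'n"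
  assumes "finite J" "card J < CARD('n)"
  shows "\<exists>v. norm v = 1 \<and> (\<forall>j\<in>J. hinner (z j) v = 0) \<and>
    (\<forall>x. (\<forall>j\<in>J. hinner (z j) x = 0) \<longrightarrow> norm (G *v x) \<le> norm (G *v v) * norm x)"
proof -
  define S where "S = sphere 0 1 \<inter> (\<Inter>j\<in>J. hinner (z j) -` {0})"
  have "closed (hinner (z j) -` {0})" for j
    by (intro closed_vimage) (auto intro: continuous_on_hinner)
  then have compact: "compact S"
    unfolding S_def by (intro compact_Int_closed closed_INT) auto
  have nonempty: "S \<noteq> {}"
    using exists_unit_orthogonal[OF assms, of z] by (auto simp: S_def)
  have "continuous_on S (\<lambda>x. norm (G *v x))"
    by (rule continuous_on_norm[OF linear_continuous_on[OF bounded_linear_matrix_vector_mult]])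
  from continuous_attains_sup[OF compact nonempty this]
  obtain v where v: "v \<in> S" "\<And>y. y \<in> S \<Longrightarrow> norm (G *v y) \<le> norm (G *v v)"
    by blast
  have "norm (G *v x) \<le> norm (G *v v) * norm x" if x: "\<forall>j\<in>J. hinner (z j) x = 0" for x
  proof (cases "x = 0")
    case False
    then have "(1 / norm x) *\<^sub>R x \<in> S"
      using x by (simp add: S_def hinner_scaleR_right)
    then have "norm (G *v ((1 / norm x) *\<^sub>R x)) \<le> norm (G *v v)" by (rule v(2))
    then show ?thesis
      using False
      by (simp add: linear_scale[OF bounded_linear.linear[OF bounded_linear_matrix_vector_mult]] field_simps)
  qed simp
  with v(1) show ?thesis by (auto simp: S_def)
qed

text \<open>
  The invariant of the greedy construction. Invariance of the singular directions under both \<open>G\<close> and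
  its adjoint makes the orthogonal complements invariant, so that the next pair of vectors can be
  found there; the last clause ensures that the next singular value is not larger.
\<close>

definition partial_svd ::
  "complex^'n^'m \<Rightarrow> nat \<Rightarrow> (nat \<Rightarrow> real) \<Rightarrow> (nat \<Rightarrow> complex^'m) \<Rightarrow> (nat \<Rightarrow> complex^'n) \<Rightarrow> bool" where
  "partial_svd G k s u v \<longleftrightarrow>
     orthonormal_on {1..k} u \<and> orthonormal_on {1..k} v \<and>
     (\<forall>i\<in>{1..k}. 0 \<le> s i \<and> G *v v i = s i *\<^sub>R u i \<and> conj_transpose G *v u i = s i *\<^sub>R v i) \<and>
     (\<forall>i\<in>{1..k}. \<forall>j\<in>{i..k}. s j \<le> s i) \<and>
     (\<forall>x. \<forall>i\<in>{1..k}. (\<forall>j\<in>{1..k}. hinner (v j) x = 0) \<longrightarrow> norm (G *v x) \<le> s i * norm x)"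

text \<open>
  A maximiser of \<open>\<parallel>G x\<parallel>\<close> is an eigenvector of \<open>G\<^sup>H G\<close>, by the equality case of the Cauchy-Schwarz
  inequality in place of a derivative. With \<open>y = G\<^sup>H G v\<close>,
  \<open>\<parallel>y\<parallel>\<^sup>2 = \<langle>G v, G y\<rangle> \<le> \<sigma>\<^sup>2 \<parallel>y\<parallel>\<close> gives \<open>\<parallel>y\<parallel> \<le> \<sigma>\<^sup>2\<close>, while \<open>\<langle>y, v\<rangle> = \<sigma>\<^sup>2\<close>; so
  \<open>\<parallel>y - \<sigma>\<^sup>2 v\<parallel>\<^sup>2 \<le> 0\<close>. The set \<open>P\<close> over which \<open>v\<close> is maximal has to contain \<open>y\<close>, the point
  at which maximality is applied.
\<close>

lemma conj_transpose_mult_maximizer: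
  assumes v: "norm v = 1" "\<sigma> = norm (G *v v)"
    and max: "\<And>x. P x \<Longrightarrow> norm (G *v x) \<le> \<sigma> * norm x"
    and P: "P (conj_transpose G *v (G *v v))"
  shows "conj_transpose G *v (G *v v) = (\<sigma>\<^sup>2) *\<^sub>R v"
proof -
  define y where "y = conj_transpose G *v (G *v v)"
  have "(norm y)\<^sup>2 = Re (hinner y y)"
    by (simp add: hinner_self)
  also have "\<dots> = (G *v v) \<bullet> (G *v y)"
    by (subst (1) y_def) (simp add: hinner_adjoint Re_hinner)
  also have "\<dots> \<le> \<sigma> * (\<sigma> * norm y)"
    using norm_cauchy_schwarz[of "G *v v" "G *v y"] max[OF P] v(2)
    by (smt (verit) mult_left_mono norm_ge_zero y_def)
  finally have "norm y * norm y \<le> \<sigma>\<^sup>2 * norm y"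
    by (simp add: power2_eq_square)
  then have le: "norm y \<le> \<sigma>\<^sup>2"
    by (cases "y = 0") (simp, metis mult_right_le_imp_le zero_less_norm_iff)
  have "y \<bullet> v = Re (hinner (G *v v) (G *v v))"
    by (simp add: y_def hinner_adjoint flip: Re_hinner)
  then have yv: "y \<bullet> v = \<sigma>\<^sup>2"
    by (simp add: hinner_self v(2))
  have "(norm (y - \<sigma>\<^sup>2 *\<^sub>R v))\<^sup>2 = (norm y)\<^sup>2 - 2 * \<sigma>\<^sup>2 * (y \<bullet> v) + \<sigma>\<^sup>2 * \<sigma>\<^sup>2 * (norm v)\<^sup>2"
    by (simp add: power2_norm_eq_inner inner_diff_left inner_diff_right inner_commute algebra_simps)
  also have "\<dots> = (norm y)\<^sup>2 - (\<sigma>\<^sup>2)\<^sup>2"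
    using v(1) yv by (simp add: power2_eq_square)
  also have "\<dots> \<le> 0"
    using power_mono[OF le norm_ge_zero, of 2] by simp
  finally show ?thesis by (simp add: y_def)
qed

text \<open>
  If the maximum \<open>\<sigma>\<close> is positive, the new left vector is \<open>G v' / \<sigma>\<close>. If it is zero, \<open>G\<close> vanishes on the
  complement of the chosen right vectors, and any unit vector orthogonal to the chosen left vectors
  lies in the kernel of the adjoint.
\<close>

lemma partial_svd_Suc:
  fixes G :: "complex^'n^'m"
  assumes part: "partial_svd G k s u v" and k: "k < CARD('n)" "k < CARD('m)"
  shows "\<exists>s u v. partial_svd G (Suc k) s u v"
proof -
  let ?H = "conj_transpose G"
  have ou: "orthonormal_on {1..k} u" and ov: "orthonormal_on {1..k} v"
    and s0: "\<And>i. i \<in> {1..k} \<Longrightarrow> 0 \<le> s i"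
    and Gv: "\<And>i. i \<in> {1..k} \<Longrightarrow> G *v v i = s i *\<^sub>R u i"
    and Hu: "\<And>i. i \<in> {1..k} \<Longrightarrow> ?H *v u i = s i *\<^sub>R v i"
    and anti: "\<And>i j. i \<in> {1..k} \<Longrightarrow> j \<in> {i..k} \<Longrightarrow> s j \<le> s i"
    and bound: "\<And>x i. i \<in> {1..k} \<Longrightarrow> \<forall>j\<in>{1..k}. hinner (v j) x = 0 \<Longrightarrow>
                  norm (G *v x) \<le> s i * norm x"
    using part by (auto simp: partial_svd_def)
  obtain v' where v': "norm v' = 1" "\<forall>j\<in>{1..k}. hinner (v j) v' = 0"
    and max: "\<And>x. \<forall>j\<in>{1..k}. hinner (v j) x = 0 \<Longrightarrow> norm (G *v x) \<le> norm (G *v v') * norm x"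
    using exists_norm_maximizer_orthogonal[of "{1..k}" v G] k(1) by auto
  define \<sigma> where "\<sigma> = norm (G *v v')"
  have orthG: "hinner (u j) (G *v v') = 0" if "j \<in> {1..k}" for j
    using v'(2) that Hu[OF that] by (simp add: hinner_adjoint[symmetric] hinner_scaleR_left)
  have orthH: "hinner (v j) (?H *v y) = 0" if "j \<in> {1..k}" "hinner (u j) y = 0" for j y
  proof -
    have "hinner (?H *v y) (v j) = 0"
      using that by (simp add: hinner_adjoint Gv hinner_scaleR_right hinner_eq_0_commute[of y])
    then show ?thesis by (simp add: hinner_eq_0_commute)
  qed
  have HG: "?H *v (G *v v') = \<sigma>\<^sup>2 *\<^sub>R v'"
    by (rule conj_transpose_mult_maximizer[where P = "\<lambda>x. \<forall>j\<in>{1..k}. hinner (v j) x = 0"])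
      (use v' max orthH orthG in \<open>auto simp: \<sigma>_def\<close>)
  obtain u' where u': "norm u' = 1" "\<forall>j\<in>{1..k}. hinner (u j) u' = 0"
    "G *v v' = \<sigma> *\<^sub>R u'" "?H *v u' = \<sigma> *\<^sub>R v'"
  proof (cases "\<sigma> = 0")
    case False
    show ?thesis
    proof (rule that[of "inverse \<sigma> *\<^sub>R (G *v v')"])
      have "?H *v (inverse \<sigma> *\<^sub>R (G *v v')) = inverse \<sigma> *\<^sub>R (?H *v (G *v v'))"
        by (rule linear_scale[OF bounded_linear.linear[OF bounded_linear_matrix_vector_mult]])
      then show "?H *v (inverse \<sigma> *\<^sub>R (G *v v')) = \<sigma> *\<^sub>R v'"
        using False by (simp add: HG power2_eq_square)
    qed (use False orthG in \<open>auto simp: \<sigma>_def hinner_scaleR_right\<close>)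
  next
    case True
    obtain u' where u': "norm u' = 1" "\<forall>j\<in>{1..k}. hinner (u j) u' = 0"
      using exists_unit_orthogonal[of "{1..k}" u] k(2) by auto
    have "norm (G *v (?H *v u')) \<le> \<sigma> * norm (?H *v u')"
      unfolding \<sigma>_def by (rule max) (use orthH u'(2) in blast)
    then have "G *v (?H *v u') = 0" using True by simp
    then have "hinner (?H *v u') (?H *v u') = 0"
      by (simp add: hinner_adjoint)
    then show ?thesis
      using u' True by (intro that[of u']) (auto simp: \<sigma>_def)
  qed
  have extend: "orthonormal_on {1..Suc k} (w(Suc k := w'))"
    if "orthonormal_on {1..k} w" "norm w' = 1" "\<forall>j\<in>{1..k}. hinner (w j) w' = 0"
    for w :: "nat \<Rightarrow> complex^'l" and w'
    using that hinner_self[of w'] hinner_eq_0_commute[of w']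
    by (auto simp: orthonormal_on_def atLeastAtMostSuc_conv)
  have le: "\<sigma> \<le> s i" if "i \<in> {1..k}" for i
    using bound[OF that v'(2)] v'(1) by (simp add: \<sigma>_def)
  have "partial_svd G (Suc k) (s(Suc k := \<sigma>)) (u(Suc k := u')) (v(Suc k := v'))"
    unfolding partial_svd_def
  proof (intro conjI allI ballI impI)
    fix i assume "i \<in> {1..Suc k}"
    then show "0 \<le> (s(Suc k := \<sigma>)) i"
      "G *v (v(Suc k := v')) i = (s(Suc k := \<sigma>)) i *\<^sub>R (u(Suc k := u')) i"
      "?H *v (u(Suc k := u')) i = (s(Suc k := \<sigma>)) i *\<^sub>R (v(Suc k := v')) i"
      using s0 Gv Hu u' by (auto simp: \<sigma>_def)
  next
    fix i j assume "i \<in> {1..Suc k}" "j \<in> {i..Suc k}"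
    then show "(s(Suc k := \<sigma>)) j \<le> (s(Suc k := \<sigma>)) i"
      using anti[of i j] le[of i] by auto
  next
    fix x i assume i: "i \<in> {1..Suc k}"
      and orth: "\<forall>j\<in>{1..Suc k}. hinner ((v(Suc k := v')) j) x = 0"
    have x: "\<forall>j\<in>{1..k}. hinner (v j) x = 0"
    proof
      show "hinner (v j) x = 0" if "j \<in> {1..k}" for j
        using orth[rule_format, of j] that by simp
    qed
    have "norm (G *v x) \<le> \<sigma> * norm x"
      using max[OF x] by (simp add: \<sigma>_def)
    then show "norm (G *v x) \<le> (s(Suc k := \<sigma>)) i * norm x"
      using bound[OF _ x, of i] i by (cases "i = Suc k") auto
  qed (use extend[OF ou u'(1,2)] extend[OF ov v'] in auto)
  then show ?thesis by (intro exI)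
qed

lemma exists_partial_svd:
  fixes G :: "complex^'n^'m"
  assumes "k \<le> CARD('n)" "k \<le> CARD('m)"
  shows "\<exists>s u v. partial_svd G k s u v"
  using assms
proof (induction k)
  case 0
  show ?case by (simp add: partial_svd_def orthonormal_on_def)
next
  case (Suc k)
  have k: "k < CARD('n)" "k < CARD('m)"
    using Suc.prems by (simp_all only: Suc_le_eq)
  then obtain s u v where "partial_svd G k s u v"
    using Suc.IH less_imp_le by blast
  then show ?case by (rule partial_svd_Suc[OF _ k])
qed

lemma is_svd_iff:
  fixes G :: "complex^'n^'m"
  shows "is_svd G s u v \<longleftrightarrow>
    (\<forall>j. 0 \<le> s j) \<and> (\<forall>i j. 1 \<le> i \<longrightarrow> i \<le> j \<longrightarrow> s j \<le> s i) \<and>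
    (\<forall>j>min CARD('m) CARD('n). s j = 0) \<and>
    orthonormal_on {1..min CARD('m) CARD('n)} u \<and> orthonormal_on {1..min CARD('m) CARD('n)} v \<and>
    G = rank_one_sum {1..min CARD('m) CARD('n)} s u v"
  unfolding is_svd_def Let_def orthonormal_upto_iff rank_one_sum_def ..

text \<open>
  After \<open>min m n\<close> steps the right or the left vectors form an orthonormal basis. Expanding \<open>x\<close>
  in the first case, or \<open>G x\<close> in the second, yields the decomposition.
\<close>

lemma exists_svd:
  fixes G :: "complex^'n^'m"
  shows "\<exists>s u v. is_svd G s u v"
proof -
  define p where "p = min CARD('m) CARD('n)"
  obtain s u v where part: "partial_svd G p s u v"
    using exists_partial_svd[of p G] by (auto simp: p_def)
  define t where "t j = (if j \<in> {1..p} then s j else 0)" for j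
  have ou: "orthonormal_on {1..p} u" and ov: "orthonormal_on {1..p} v"
    using part by (auto simp: partial_svd_def)
  have t: "G *v v i = of_real (t i) *s u i" "conj_transpose G *v u i = of_real (t i) *s v i"
    if "i \<in> {1..p}" for i
    using part that
    by (auto simp: partial_svd_def t_def vec_eq_iff scaleR_conv_of_real[of _ "_ :: complex"])
  have "G *v x = rank_one_sum {1..p} t u v *v x" for x
  proof (cases "p = CARD('n)")
    case True
    have "G *v x = G *v (\<Sum>i\<in>{1..p}. hinner (v i) x *s v i)"
      using orthonormal_expansion[OF _ ov] True by simp
    also have "\<dots> = (\<Sum>i\<in>{1..p}. hinner (v i) x *s (G *v v i))"
      by (simp add: linear_sum[OF bounded_linear.linear[OF bounded_linear_matrix_vector_mult]]
          vector_scalar_commute)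
    also have "\<dots> = rank_one_sum {1..p} t u v *v x"
      unfolding rank_one_sum_mult_vec by (rule sum.cong) (simp_all add: t mult.commute)
    finally show ?thesis .
  next
    case False
    then have p: "p = CARD('m)" by (simp add: p_def min_def split: if_splits)
    have "G *v x = (\<Sum>i\<in>{1..p}. hinner (u i) (G *v x) *s u i)"
      using orthonormal_expansion[OF _ ou] p by simp
    also have "\<dots> = rank_one_sum {1..p} t u v *v x"
      unfolding rank_one_sum_mult_vec
      by (rule sum.cong) (simp_all add: t hinner_adjoint[symmetric] hinner_smult_left)
    finally show ?thesis .
  qed
  then have "G = rank_one_sum {1..p} t u v" by (simp add: matrix_eq)
  moreover have "\<forall>j. 0 \<le> t j" "\<forall>i j. 1 \<le> i \<longrightarrow> i \<le> j \<longrightarrow> t j \<le> t i" "\<forall>j>p. t j = 0"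
    using part by (auto simp: t_def partial_svd_def)
  ultimately have "is_svd G t u v"
    using ou ov by (simp add: is_svd_iff flip: p_def)
  then show ?thesis by blast
qed

lemma svd_is_svd:
  assumes "svd G = (s, u, v)"
  shows "is_svd G s u v"
proof -
  have "\<exists>z. (\<lambda>(s, u, v). is_svd G s u v) z"
    using exists_svd[of G] by auto
  from someI_ex[OF this] show ?thesis
    using assms by (simp add: svd_def)
qed

section \<open>Perturbation of singular values\<close>

lemma spectral_norm_le_singular_value_1:
  fixes G :: "complex^'n^'m"
  assumes "is_svd G s u v"
  shows "spectral_norm G \<le> s 1"
  unfolding spectral_norm_def
proof (rule onorm_le)
  fix x
  have G: "G = rank_one_sum {1..min CARD('m) CARD('n)} s u v"
    using assms by (simp only: is_svd_iff)
  show "norm (G *v x) \<le> s 1 * norm x"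
    by (subst G, rule norm_rank_one_sum_mult_vec_le) (use assms in \<open>auto simp: is_svd_iff\<close>)
qed

text \<open>
  Weyl's inequality. The span of the first \<open>r\<close> right singular vectors of \<open>A\<close>, where \<open>A\<close> stretches by
  at least \<open>s r\<close>, meets the complement of the first \<open>r - 1\<close> right singular vectors of \<open>B\<close>, where
  \<open>B\<close> stretches by at most \<open>t r\<close>, in a nonzero vector. For arbitrary decompositions the statement
  covers whatever choice \<open>svd\<close> makes.
\<close>

lemma singular_value_perturbation:
  fixes A B :: "complex^'n^'m"
  assumes A: "is_svd A s u v" and B: "is_svd B t w z" and r: "1 \<le> r"
  shows "s r \<le> t r + spectral_norm (A - B)"
proof (cases "r \<le> min CARD('m) CARD('n)")
  case False
  then have "s r = 0" "0 \<le> t r" using A B by (auto simp: is_svd_iff)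
  then show ?thesis using spectral_norm_nonneg[of "A - B"] by simp
next
  case True
  define p where "p = min CARD('m) CARD('n)"
  have ou: "orthonormal_on {1..p} u" and ov: "orthonormal_on {1..p} v"
    and ow: "orthonormal_on {1..p} w" and oz: "orthonormal_on {1..p} z"
    and Aeq: "A = rank_one_sum {1..p} s u v" and Beq: "B = rank_one_sum {1..p} t w z"
    and s: "\<And>j. 0 \<le> s j" "\<And>i j. 1 \<le> i \<Longrightarrow> i \<le> j \<Longrightarrow> s j \<le> s i"
    and t: "\<And>j. 0 \<le> t j" "\<And>i j. 1 \<le> i \<Longrightarrow> i \<le> j \<Longrightarrow> t j \<le> t i"
    using A B by (simp_all add: is_svd_iff p_def)
  have sub: "{1..r} \<subseteq> {1..p}" using True by (auto simp: p_def)
  have ovr: "orthonormal_on {1..r} v" by (rule orthonormal_on_subset[OF ov sub])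
  have "vec.dim (vec.span (v ` {1..r})) = r"
    using orthonormal_on_independent[OF _ ovr]
    by (simp add: vec.dim_span vec.dim_eq_card_independent)
  then obtain x where x: "x \<in> vec.span (v ` {1..r})" "x \<noteq> 0" "\<forall>j\<in>{1..<r}. hinner (z j) x = 0"
    using exists_orthogonal_in_subspace[OF vec.subspace_span, of "{1..<r}" "v ` {1..r}" z] r by auto
  have "(s r * norm x)\<^sup>2 = (\<Sum>j\<in>{1..r}. (s r)\<^sup>2 * (cmod (hinner (v j) x))\<^sup>2)"
    using norm_orthonormal_sum[OF _ ovr, of "\<lambda>j. hinner (v j) x"]
      orthonormal_expansion_span[OF _ ovr x(1)]
    by (simp add: power_mult_distrib sum_distrib_left)
  also have "\<dots> \<le> (\<Sum>j\<in>{1..r}. (s j)\<^sup>2 * (cmod (hinner (v j) x))\<^sup>2)"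
    by (intro sum_mono mult_right_mono power_mono s) auto
  also have "\<dots> \<le> (\<Sum>j\<in>{1..p}. (s j)\<^sup>2 * (cmod (hinner (v j) x))\<^sup>2)"
    by (rule sum_mono2[OF _ sub]) auto
  also have "\<dots> = (norm (A *v x))\<^sup>2"
    by (simp only: Aeq norm_rank_one_sum_mult_vec[OF finite_atLeastAtMost ou])
  finally have lower: "s r * norm x \<le> norm (A *v x)"
    by (rule power2_le_imp_le) simp
  have upper: "norm (B *v x) \<le> t r * norm x"
    unfolding Beq
  proof (rule norm_rank_one_sum_mult_vec_le)
    fix j assume j: "j \<in> {1..p}" "hinner (z j) x \<noteq> 0"
    then have "r \<le> j" using x(3) by (meson atLeastAtMost_iff atLeastLessThan_iff not_le)
    then show "\<bar>t j\<bar> \<le> t r" using t r by simp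
  qed (use ow oz t in auto)
  have "norm (A *v x) = norm (B *v x + (A - B) *v x)"
    by (simp flip: matrix_vector_mult_add_rdistrib)
  also have "\<dots> \<le> t r * norm x + spectral_norm (A - B) * norm x"
    by (rule norm_triangle_mono[OF upper norm_matrix_vector_mult_le])
  finally have "s r * norm x \<le> (t r + spectral_norm (A - B)) * norm x"
    using lower by (simp add: algebra_simps)
  then show ?thesis using x(2) by simp
qed

section \<open>The numerical solution nearest to a given vector\<close>

lemma theta_proj_rank_one_sum:
  fixes G :: "complex^'n^'m"
  assumes "svd G = (s, u, v)"
  shows "theta_proj \<theta> G =
    rank_one_sum {1..min CARD('m) CARD('n)} (\<lambda>j. if s j > \<theta> then s j else 0) u v"
  unfolding theta_proj_def assms rank_one_sum_def
  by (simp add: if_distrib[of "\<lambda>c. c *\<^sub>R _"] cong: if_cong)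
    (rule sum.mono_neutral_cong_left; auto)

text \<open>
  The solutions of the projected system form a translate of the kernel of \<open>P\<close>. Correcting \<open>x\<close> by
  \<open>X (d - P x)\<close> reaches this set, and \<open>X P = X G\<close> rewrites the correction through the residual
  of \<open>x\<close> in the original system.
\<close>

lemma sol_theta_near:
  fixes G :: "complex^'n^'m"
  assumes r: "1 \<le> r"
    and \<theta>: "singular_value G (r + 1) < \<theta>" "\<theta> < singular_value G r" "theta_dist \<theta> G d < \<theta>"
  shows "\<exists>y\<in>sol_theta \<theta> G d. norm (y - x) \<le> norm (d - G *v x) / singular_value G r"
proof -
  define p where "p = min CARD('m) CARD('n)"
  obtain s u v where svd: "svd G = (s, u, v)" by (metis prod_cases3)
  have sv: "singular_value G = s"
    by (simp add: fun_eq_iff singular_value_def svd)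
  have ou: "orthonormal_on {1..p} u" and ov: "orthonormal_on {1..p} v"
    and Geq: "G = rank_one_sum {1..p} s u v"
    and s: "\<And>j. 0 \<le> s j" "\<And>i j. 1 \<le> i \<Longrightarrow> i \<le> j \<Longrightarrow> s j \<le> s i"
    using svd_is_svd[OF svd] by (simp_all add: is_svd_iff p_def)
  have \<theta>0: "0 < \<theta>" using s(1)[of "r + 1"] \<theta>(1) by (simp add: sv)
  \<comment> \<open>The values at or above \<open>\<theta>\<close> are those at indices up to \<open>r\<close>. Hence \<open>\<theta>\<close> is no singular value,
     and the coefficients kept by the projection are at least \<open>s r\<close>.\<close>
  have sep: "s r \<le> s j" if "1 \<le> j" "\<not> s j < \<theta>" for j
    using that s(2)[of "r + 1" j] s(2)[of j r] \<theta>(1) by (cases "j \<le> r") (auto simp: sv)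
  define c where "c j = (if s j > \<theta> then s j else 0)" for j
  define P where "P = theta_proj \<theta> G"
  define X where "X = moore_penrose P"
  note mult = rank_one_sum_mult[OF finite_atLeastAtMost ou]
    rank_one_sum_mult[OF finite_atLeastAtMost ov]
  have Peq: "P = rank_one_sum {1..p} c u v"
    unfolding P_def theta_proj_rank_one_sum[OF svd] p_def c_def ..
  have Xeq: "X = rank_one_sum {1..p} (\<lambda>j. inverse (c j)) v u"
    unfolding X_def Peq by (rule moore_penrose_rank_one_sum[OF finite_atLeastAtMost ou ov])
  have cc: "c j * inverse (c j) * c j = c j" "inverse (c j) * s j = inverse (c j) * c j" for j
    by (cases "s j = 0"; simp add: c_def)+
  have PXP: "P ** X ** P = P"
    by (simp only: Peq Xeq mult cc)
  have XG: "X ** G = X ** P"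
    unfolding Xeq Peq by (subst Geq) (simp only: mult cc)
  define y where "y = x + X *v (d - P *v x)"
  have "P *v y = P *v x + (P ** X) *v d - (P ** X ** P) *v x"
    by (simp add: y_def matrix_vector_right_distrib matrix_vector_mult_diff_distrib
        matrix_vector_mul_assoc matrix_mul_assoc)
  also have "\<dots> = (P ** X) *v d" by (simp add: PXP)
  finally have "y \<in> sol_theta \<theta> G d"
    using \<theta> \<theta>0 sep by (fastforce simp: sol_theta_def sol_def theta_proj_vec_def P_def X_def sv)
  moreover have "norm (y - x) \<le> norm (d - G *v x) / singular_value G r"
  proof -
    have "y - x = X *v d - (X ** P) *v x"
      by (simp add: y_def matrix_vector_mult_diff_distrib matrix_vector_mul_assoc)
    also have "\<dots> = X *v (d - G *v x)"
      by (simp add: XG[symmetric] matrix_vector_mult_diff_distrib matrix_vector_mul_assoc)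
    finally have "y - x = X *v (d - G *v x)" .
    moreover have "norm (X *v (d - G *v x)) \<le> inverse (s r) * norm (d - G *v x)"
      unfolding Xeq
    proof (rule norm_rank_one_sum_mult_vec_le)
      fix j assume "j \<in> {1..p}"
      then show "\<bar>inverse (c j)\<bar> \<le> inverse (s r)"
        using sep[of j] \<theta> \<theta>0 by (auto simp: c_def sv intro!: le_imp_inverse_le)
    qed (use ou ov s in auto)
    ultimately show ?thesis by (simp add: sv divide_inverse mult.commute)
  qed
  ultimately show ?thesis by blast
qed

theorem theorem5:
  fixes A \<Delta>A A' :: "complex^'n^'m"
    and b \<Delta>b b' :: "complex^'m"
    and x :: "complex^'n"
    and r :: nat
  assumes "b = A *v x"
    and "b \<noteq> 0"
    and "1 \<le> r"
    and "singular_value A r > singular_value A (r + 1)"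
    and "A' = A + \<Delta>A"
    and "b' = b + \<Delta>b"
    and "serves_as_data r A' b'"
    and "spectral_norm \<Delta>A
           < min (singular_value A r - singular_value A (r + 1))
                 ((2 * sqrt 3 - 3) * singular_value A r)"
  shows "\<exists>\<theta>. singular_value A' (r + 1) < \<theta> \<and> \<theta> < singular_value A' r \<and>
           (\<exists>x'\<in>sol_theta \<theta> A' b'.
              norm (x' - x) / norm x
                \<le> singular_value A 1 / singular_value A r
                  * (1 / (1 - (singular_value A (r + 1) + spectral_norm \<Delta>A) / singular_value A r))
                  * ((2 + sqrt 2) * (spectral_norm \<Delta>A / spectral_norm A)
                     + norm \<Delta>b / norm b))"
proof -
  define e where "e = spectral_norm \<Delta>A"
  define s where "s = singular_value A"
  obtain u v where "svd A = (s, u, v)"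
    unfolding s_def singular_value_def by (metis prod.collapse ext)
  then have svdA: "is_svd A s u v" by (rule svd_is_svd)
  obtain u' v' where "svd A' = (singular_value A', u', v')"
    unfolding singular_value_def by (metis prod.collapse ext)
  then have svdA': "is_svd A' (singular_value A') u' v'" by (rule svd_is_svd)
  have s: "0 \<le> s (r + 1)" "s (r + 1) + e < s r" and e: "0 \<le> e"
    using svdA assms(8) by (auto simp: is_svd_iff e_def s_def spectral_norm_nonneg)
  have "(A - A') *v y = - (\<Delta>A *v y)" for y
    by (simp add: assms(5) vec_eq_iff matrix_vector_mult_def sum_negf)
  then have "spectral_norm (A - A') = e"
    by (simp add: e_def spectral_norm_def onorm_neg)
  then have weyl: "s r - e \<le> singular_value A' r"
    using singular_value_perturbation[OF svdA svdA' assms(3)] by simp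
  obtain \<theta> where \<theta>: "singular_value A' (r + 1) < \<theta>" "\<theta> < singular_value A' r" "theta_dist \<theta> A' b' < \<theta>"
    using assms(7) by (auto simp: serves_as_data_def)
  obtain x' where x': "x' \<in> sol_theta \<theta> A' b'"
    and near: "norm (x' - x) \<le> norm (b' - A' *v x) / singular_value A' r"
    using sol_theta_near[OF assms(3) \<theta>] by blast
  have x0: "0 < norm x" using assms(1,2) by auto
  have b0: "0 < norm b" using assms(2) by simp
  have bA: "norm b \<le> spectral_norm A * norm x"
    unfolding assms(1) by (rule norm_matrix_vector_mult_le)
  then have A0: "0 < spectral_norm A"
    using b0 x0 by (metis less_le_trans zero_less_mult_pos2)
  have As: "spectral_norm A \<le> s 1" by (rule spectral_norm_le_singular_value_1[OF svdA])
  have gap: "0 < s r - s (r + 1) - e" "s r - s (r + 1) - e \<le> s r - e" using s by simp_all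
  have "b' - A' *v x = \<Delta>b - \<Delta>A *v x"
    by (simp add: assms(1,5,6) matrix_vector_mult_add_rdistrib)
  then have res: "norm (b' - A' *v x) \<le> norm \<Delta>b + e * norm x"
    using norm_triangle_ineq4[of \<Delta>b "\<Delta>A *v x"] norm_matrix_vector_mult_le[of \<Delta>A x]
    by (simp add: e_def)
  have "norm (x' - x) \<le> (norm \<Delta>b + e * norm x) / (s r - s (r + 1) - e)"
    by (rule order_trans[OF near frac_le]) (use res gap weyl e in auto)
  then have "norm (x' - x) / norm x \<le> (norm \<Delta>b + e * norm x) / (s r - s (r + 1) - e) / norm x"
    by (rule divide_right_mono) simp
  also have "\<dots> = (norm \<Delta>b / norm x + e) / (s r - s (r + 1) - e)"
    using x0 by (simp add: add_divide_distrib)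
  also have "\<dots> \<le> s 1 * ((2 + sqrt 2) * (e / spectral_norm A) + norm \<Delta>b / norm b)
      / (s r - s (r + 1) - e)"
  proof (rule divide_right_mono)
    have "norm b \<le> s 1 * norm x"
      using bA As x0 by (meson mult_right_mono norm_ge_zero order_trans)
    then have "norm \<Delta>b * norm b \<le> norm \<Delta>b * (s 1 * norm x)"
      by (rule mult_left_mono) simp
    then have "norm \<Delta>b / norm x \<le> s 1 * (norm \<Delta>b / norm b)"
      using x0 b0 by (simp add: field_simps)
    moreover have "1 * e \<le> (s 1 / spectral_norm A * (2 + sqrt 2)) * e"
    proof (rule mult_right_mono[OF _ e])
      have "1 * 1 \<le> s 1 / spectral_norm A * (2 + sqrt 2)"
        by (rule mult_mono) (use As A0 in auto)
      then show "1 \<le> s 1 / spectral_norm A * (2 + sqrt 2)" by simp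
    qed
    ultimately show "norm \<Delta>b / norm x + e
        \<le> s 1 * ((2 + sqrt 2) * (e / spectral_norm A) + norm \<Delta>b / norm b)"
      by (simp add: algebra_simps)
  qed (use gap in simp)
  also have "\<dots> = s 1 / s r * (1 / (1 - (s (r + 1) + e) / s r))
      * ((2 + sqrt 2) * (e / spectral_norm A) + norm \<Delta>b / norm b)"
  proof -
    have "s r > 0" using s e by linarith
    then have "s r * (1 - (s (r + 1) + e) / s r) = s r - s (r + 1) - e"
      by (simp add: field_simps)
    then have "s 1 / s r * (1 / (1 - (s (r + 1) + e) / s r)) = s 1 / (s r - s (r + 1) - e)"
      by (metis divide_divide_eq_left mult.right_neutral times_divide_eq_right)
    then show ?thesis by (simp only: times_divide_eq_left)
  qed
  finally show ?thesis
    using \<theta>(1,2) x' unfolding s_def e_def by blast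
qed

end
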